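(* Let $(\Omega,\mathcal{F},\mathbb{P})$ be a probability space and let $\alpha\in(0,1)$. The following statements are equivalent: (a) There exists a risky eligible asset $S$ such that $S\text{-}\mathrm{VaR}_\alpha$ is comonotonic. (b) There exists $A\in\mathcal{F}$ such that $0<\mathbb{P}(A)\leq\alpha$ and for every $B\in\mathcal{F}$ we have \[ \mathbb{P}(B)\leq\alpha \ \implies \ \mathbb{P}(A)+\mathbb{P}(A^c\cap B)\leq\alpha. \]
   Context: $L^\infty=L^\infty(\Omega,\mathcal{F},\mathbb{P})$ is the space of (a.s.-equivalence classes of) essentially bounded real random variables, and $L^\infty_+=\{X\in L^\infty : X\ge 0 \text{ a.s.}\}$. An eligible asset is a pair $S=(S_0,S_1)\in(0,\infty)\times L^\infty_+$ with $S_1\ge\varepsilon$ a.s. for some constant $\varepsilon>0$; $S$ is risk-free if $S_1$ is (a.s.) constant, and risky otherwise. For an eligible asset $S$, the risk measure $S\text{-}\mathrm{VaR}_\alpha:L^\infty\to\mathbb{R}$ is defined by $S\text{-}\mathrm{VaR}_\alpha(X)=\inf\{m\in\mathbb{R} : \mathbb{P}(X+\tfrac{m}{S_0}S_1<0)\leq\alpha\}$. Two random variables $X,Y\in L^\infty$ are comonotone if there is a $\mathbb{P}\otimes\mathbb{P}$-null set $N$ such that $(X(\omega)-X(\omega'))(Y(\omega)-Y(\omega'))\ge0$ for all $(\omega,\omega')\in(\Omega\times\Omega)\setminus N$. A functional $\rho:L^\infty\to\mathbb{R}$ is comonotonic if $\rho(X+Y)=\rho(X)+\rho(Y)$ for all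 comonotone $X,Y\in L^\infty$. *)

theory Defs
  imports "HOL-Probability.Probability"
begin

text \<open>
  Elements of the space of essentially bounded random variables are represented by
  measurable functions rather than by classes modulo almost sure equality. All notions below
  depend on a random variable only through its class; for \<open>SVaR\<close> this is lemma \<open>SVaR_cong\<close>.
\<close>

definition Linfty :: "'a measure \<Rightarrow> ('a \<Rightarrow> real) set" where
  "Linfty M = {X \<in> borel_measurable M. \<exists>C. AE \<omega> in M. \<bar>X \<omega>\<bar> \<le> C}"

definition Linfty_nonneg :: "'a measure \<Rightarrow> ('a \<Rightarrow> real) set" where
  "Linfty_nonneg M = {X \<in> Linfty M. AE \<omega> in M. 0 \<le> X \<omega>}"

definition eligible_asset :: "'a measure \<Rightarrow> real \<times> ('a \<Rightarrow> real) \<Rightarrow> bool" where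
  "eligible_asset M S \<longleftrightarrow>
     fst S > 0 \<and> snd S \<in> Linfty_nonneg M \<and> (\<exists>\<epsilon>>0. AE \<omega> in M. \<epsilon> \<le> snd S \<omega>)"

definition risk_free :: "'a measure \<Rightarrow> real \<times> ('a \<Rightarrow> real) \<Rightarrow> bool" where
  "risk_free M S \<longleftrightarrow> (\<exists>c. AE \<omega> in M. snd S \<omega> = c)"

abbreviation risky :: "'a measure \<Rightarrow> real \<times> ('a \<Rightarrow> real) \<Rightarrow> bool" where
  "risky M S \<equiv> \<not> risk_free M S"

text \<open>
  For an eligible asset, \<open>0 < \<alpha> < 1\<close> and \<open>X \<in> Linfty M\<close>, the set below is nonempty and bounded
  from below, so the infimum in the reals is the intended one.
\<close>

definition SVaR ::
    "'a measure \<Rightarrow> real \<times> ('a \<Rightarrow> real) \<Rightarrow> real \<Rightarrow> ('a \<Rightarrow> real) \<Rightarrow> real" where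
  "SVaR M S \<alpha> X =
     Inf {m. measure M {\<omega> \<in> space M. X \<omega> + m / fst S * snd S \<omega> < 0} \<le> \<alpha>}"

lemma SVaR_cong:
  assumes [measurable]: "X \<in> borel_measurable M" "Y \<in> borel_measurable M"
    "S1 \<in> borel_measurable M" "T1 \<in> borel_measurable M"
    and "AE \<omega> in M. X \<omega> = Y \<omega>" "AE \<omega> in M. S1 \<omega> = T1 \<omega>"
  shows "SVaR M (S0, S1) \<alpha> X = SVaR M (S0, T1) \<alpha> Y"
proof -
  have "measure M {\<omega> \<in> space M. X \<omega> + m / S0 * S1 \<omega> < 0} =
        measure M {\<omega> \<in> space M. Y \<omega> + m / S0 * T1 \<omega> < 0}" for m
    by (rule measure_eq_AE) (use assms(5,6) in \<open>auto elim: AE_mp\<close>)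
  then show ?thesis
    by (simp add: SVaR_def)
qed

text \<open>
  The quantifier \<open>AE\<close> asks precisely for a null set of the product measure outside of which the
  inequality holds.
\<close>

definition comonotone :: "'a measure \<Rightarrow> ('a \<Rightarrow> real) \<Rightarrow> ('a \<Rightarrow> real) \<Rightarrow> bool" where
  "comonotone M X Y \<longleftrightarrow>
     (AE (\<omega>, \<omega>') in M \<Otimes>\<^sub>M M. (X \<omega> - X \<omega>') * (Y \<omega> - Y \<omega>') \<ge> 0)"

definition comonotonic :: "'a measure \<Rightarrow> (('a \<Rightarrow> real) \<Rightarrow> real) \<Rightarrow> bool" where
  "comonotonic M \<rho> \<longleftrightarrow>
     (\<forall>X\<in>Linfty M. \<forall>Y\<in>Linfty M. comonotone M X Y \<longrightarrow>
        \<rho> (\<lambda>\<omega>. X \<omega> + Y \<omega>) = \<rho> X + \<rho> Y)"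

end

theory Submission
  imports Defs
begin

text \<open>
  Write \<open>U = S\<^sub>1 / S\<^sub>0\<close>. Then \<open>SVaR(X)\<close> is the upper \<open>\<alpha>\<close>-quantile of \<open>- X / U\<close>, and
  \<open>SVaR(X) \<le> m\<close> iff \<open>P(X + m U < 0) \<le> \<alpha>\<close>.

  If the functional \<open>\<rho> = SVaR\<close> is comonotonic, it is additive along constants as well as along
  \<open>U\<close>. Hence, with \<open>\<kappa> = - \<rho>(1)\<close>, it is invariant under adding multiples of \<open>V = 1 - \<kappa> U\<close>. Adding
  \<open>t V\<close> with \<open>t = 1\<close> or \<open>t = - 1\<close> to \<open>- K 1\<^sub>B\<close> for a large \<open>K\<close> turns \<open>P(B) \<le> \<alpha>\<close> into
  \<open>P({t V < 0} \<union> B) \<le> \<alpha>\<close>. As \<open>U\<close> is not constant, one of the two sets \<open>{t V < 0}\<close> has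
  positive probability and may serve as \<open>A\<close>.

  Conversely, given \<open>A\<close>, take \<open>U = 1 + 1\<^sub>A\<close>. The events \<open>{X + m U < 0}\<close> and \<open>{X + m < 0}\<close> differ only
  inside \<open>A\<close>, so one has probability at most \<open>\<alpha>\<close> iff the other has. Thus the risk measure equals the
  usual Value at Risk, a quantile, which is comonotonic.
\<close>

text \<open>In terms of the distribution function of \<open>Z\<close>, this is the generalized
  inverse (left quantile) at level 1 - \<alpha>. The strict tail \<open>m < Z \<omega>\<close>
  matches the strict inequality in \<open>SVaR\<close>.\<close>

definition upper_quantile :: "'a measure \<Rightarrow> real \<Rightarrow> ('a \<Rightarrow> real) \<Rightarrow> real" where
  "upper_quantile M \<alpha> Z = Inf {m. measure M {\<omega> \<in> space M. m < Z \<omega>} \<le> \<alpha>}"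

section \<open>Elementary facts on essentially bounded variables and comonotone pairs\<close>

lemma Linfty_measurable: "X \<in> Linfty M \<Longrightarrow> X \<in> borel_measurable M"
  by (simp add: Linfty_def)

lemma LinftyI: "X \<in> borel_measurable M \<Longrightarrow> (AE \<omega> in M. \<bar>X \<omega>\<bar> \<le> C) \<Longrightarrow> X \<in> Linfty M"
  by (auto simp: Linfty_def)

lemma LinftyE:
  assumes "X \<in> Linfty M"
  obtains C where "0 < C" "AE \<omega> in M. \<bar>X \<omega>\<bar> \<le> C"
proof -
  obtain C where "AE \<omega> in M. \<bar>X \<omega>\<bar> \<le> C"
    using assms by (auto simp: Linfty_def)
  then have "AE \<omega> in M. \<bar>X \<omega>\<bar> \<le> \<bar>C\<bar> + 1"
    by eventually_elim simp
  then show thesis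
    by (rule that[rotated]) simp
qed

lemma Linfty_const: "(\<lambda>_. c) \<in> Linfty M"
  by (rule LinftyI[where C = "\<bar>c\<bar>"]) auto

lemma Linfty_add:
  assumes "X \<in> Linfty M" "Y \<in> Linfty M"
  shows "(\<lambda>\<omega>. X \<omega> + Y \<omega>) \<in> Linfty M"
proof -
  obtain C D where "AE \<omega> in M. \<bar>X \<omega>\<bar> \<le> C" "AE \<omega> in M. \<bar>Y \<omega>\<bar> \<le> D"
    using assms by (auto elim!: LinftyE)
  then have "AE \<omega> in M. \<bar>X \<omega> + Y \<omega>\<bar> \<le> C + D"
    by eventually_elim linarith
  then show ?thesis
    using assms[THEN Linfty_measurable] by (intro LinftyI[where C = "C + D"]) measurable
qed

lemma Linfty_cmult:
  assumes "X \<in> Linfty M"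
  shows "(\<lambda>\<omega>. c * X \<omega>) \<in> Linfty M"
proof -
  obtain C where "AE \<omega> in M. \<bar>X \<omega>\<bar> \<le> C"
    using assms by (auto elim!: LinftyE)
  then have "AE \<omega> in M. \<bar>c * X \<omega>\<bar> \<le> \<bar>c\<bar> * C"
    by eventually_elim (simp add: abs_mult mult_left_mono)
  then show ?thesis
    using assms[THEN Linfty_measurable] by (intro LinftyI[where C = "\<bar>c\<bar> * C"]) measurable
qed

lemma Linfty_indicator: "A \<in> sets M \<Longrightarrow> indicator A \<in> Linfty M"
  by (rule LinftyI[where C = 1]) (auto simp: indicator_def)

lemma eligible_assetE:
  assumes "eligible_asset M (S0, S1)"
  obtains \<epsilon> where "0 < S0" "S1 \<in> Linfty M" "0 < \<epsilon>" "AE \<omega> in M. \<epsilon> \<le> S1 \<omega>"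
  using assms by (auto simp: eligible_asset_def Linfty_nonneg_def)

lemma comonotone_const: "comonotone M X (\<lambda>_. c)"
  by (simp add: comonotone_def)

lemma comonotone_uminus:
  "comonotone M X Y \<Longrightarrow> comonotone M (\<lambda>\<omega>. - X \<omega>) (\<lambda>\<omega>. - Y \<omega>)"
  unfolding comonotone_def
  by (erule eventually_mono) (auto simp: algebra_simps)

section \<open>Quantiles and their additivity on comonotone pairs\<close>

context prob_space
begin

text \<open>The admissible levels form an upward closed set, nonempty and bounded below because
  \<open>Z\<close> is essentially bounded. Right continuity of the distribution function puts the
  infimum itself into the set, which is therefore a closed half-line.\<close>

lemma upper_quantile_le_iff:
  assumes "Z \<in> Linfty M" "0 < \<alpha>" "\<alpha> < 1"
  shows "upper_quantile M \<alpha> Z \<le> m \<longleftrightarrow> prob {\<omega> \<in> space M. m < Z \<omega>} \<le> \<alpha>"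
proof -
  have Z [measurable]: "Z \<in> borel_measurable M"
    using assms(1) by (rule Linfty_measurable)
  obtain C where C: "AE \<omega> in M. \<bar>Z \<omega>\<bar> \<le> C"
    using assms(1) by (rule LinftyE)
  define T where "T = {m. prob {\<omega> \<in> space M. m < Z \<omega>} \<le> \<alpha>}"
  have up: "m' \<in> T" if "m \<in> T" "m \<le> m'" for m m'
  proof -
    have "prob {\<omega> \<in> space M. m' < Z \<omega>} \<le> prob {\<omega> \<in> space M. m < Z \<omega>}"
      using that(2) by (intro finite_measure_mono) auto
    then show ?thesis
      using that(1) by (simp add: T_def)
  qed
  have "prob {\<omega> \<in> space M. C < Z \<omega>} = 0"
    using C by (intro prob_eq_0[THEN iffD2]) (auto elim!: eventually_mono)
  then have "C \<in> T"
    using assms(2) by (simp add: T_def)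
  have bdd: "bdd_below T"
  proof (rule bdd_belowI)
    fix m assume "m \<in> T"
    show "- C \<le> m"
    proof (rule ccontr)
      assume "\<not> - C \<le> m"
      then have "prob {\<omega> \<in> space M. m < Z \<omega>} = 1"
        using C by (intro prob_Collect_eq_1[THEN iffD2]) (auto elim!: eventually_mono)
      then show False
        using \<open>m \<in> T\<close> assms(3) by (simp add: T_def)
    qed
  qed
  interpret D: real_distribution "distr M borel Z"
    by (rule real_distribution_distr) simp
  have cdf: "prob {\<omega> \<in> space M. x < Z \<omega>} = 1 - cdf (distr M borel Z) x" for x
  proof -
    have "cdf (distr M borel Z) x = prob {\<omega> \<in> space M. Z \<omega> \<le> x}"
      unfolding cdf_def by (subst measure_distr) (auto intro!: arg_cong[where f = prob])
    also have "\<dots> = 1 - prob {\<omega> \<in> space M. \<not> Z \<omega> \<le> x}"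
      by (subst prob_neg) auto
    finally show ?thesis
      by (simp add: not_le)
  qed
  have "Inf T \<in> T"
  proof -
    \<comment> \<open>Every point to the right of \<open>Inf T\<close> is admissible, so the bound
      holds there and passes to the limit from the right.\<close>
    have "1 - \<alpha> \<le> cdf (distr M borel Z) (Inf T)"
    proof (rule tendsto_lowerbound)
      show "(cdf (distr M borel Z) \<longlongrightarrow> cdf (distr M borel Z) (Inf T)) (at_right (Inf T))"
        using D.cdf_is_right_cont[of "Inf T"] by (simp add: continuous_within)
      show "eventually (\<lambda>x. 1 - \<alpha> \<le> cdf (distr M borel Z) x) (at_right (Inf T))"
        unfolding eventually_at_right_field
      proof (intro exI[of _ "Inf T + 1"] conjI allI impI)
        fix x assume "Inf T < x"
        then obtain t where "t \<in> T" "t < x"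
          using \<open>C \<in> T\<close> cInf_lessD[of T x] by auto
        then have "x \<in> T"
          using up by simp
        then show "1 - \<alpha> \<le> cdf (distr M borel Z) x"
          by (simp add: T_def cdf)
      qed simp
    qed simp
    then show ?thesis
      by (simp add: T_def cdf)
  qed
  then have "Inf T \<le> m \<longleftrightarrow> m \<in> T"
    using up bdd by (auto intro: cInf_lower)
  then show ?thesis
    by (simp add: upper_quantile_def T_def)
qed

text \<open>The superlevel sets are nested up to null sets. The two set differences \<open>C\<close>
  and \<open>D\<close> span a rectangle on which the product of increments is negative; it is a null
  set, so one of its sides is null.\<close>

lemma comonotone_superlevel:
  assumes [measurable]: "X \<in> borel_measurable M" "Y \<in> borel_measurable M"
    and "comonotone M X Y"
  shows "(AE \<omega> in M. x < X \<omega> \<longrightarrow> y < Y \<omega>) \<or> (AE \<omega> in M. y < Y \<omega> \<longrightarrow> x < X \<omega>)"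
proof -
  define C where "C = {\<omega> \<in> space M. x < X \<omega> \<and> Y \<omega> \<le> y}"
  define D where "D = {\<omega> \<in> space M. y < Y \<omega> \<and> X \<omega> \<le> x}"
  have [measurable]: "C \<in> sets M" "D \<in> sets M"
    by (auto simp: C_def D_def)
  have "AE p in M \<Otimes>\<^sub>M M. p \<notin> C \<times> D"
    using assms(3) unfolding comonotone_def
  proof (rule eventually_mono, clarify)
    fix \<omega> \<omega>' assume "0 \<le> (X \<omega> - X \<omega>') * (Y \<omega> - Y \<omega>')" "\<omega> \<in> C" "\<omega>' \<in> D"
    moreover from this have "(X \<omega> - X \<omega>') * (Y \<omega> - Y \<omega>') < 0"
      by (intro mult_pos_neg) (auto simp: C_def D_def)
    ultimately show False
      by simp
  qed
  then have "C \<times> D \<in> null_sets (M \<Otimes>\<^sub>M M)"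
    by (subst AE_iff_null_sets) auto
  then have "emeasure M C * emeasure M D = 0"
    by (auto simp: emeasure_pair_measure_Times)
  then have "C \<in> null_sets M \<or> D \<in> null_sets M"
    by auto
  then show ?thesis
  proof
    assume "C \<in> null_sets M"
    then have "AE \<omega> in M. \<omega> \<notin> C"
      by (rule AE_not_in)
    then have "AE \<omega> in M. x < X \<omega> \<longrightarrow> y < Y \<omega>"
      using AE_space by eventually_elim (auto simp: C_def)
    then show ?thesis ..
  next
    assume "D \<in> null_sets M"
    then have "AE \<omega> in M. \<omega> \<notin> D"
      by (rule AE_not_in)
    then have "AE \<omega> in M. y < Y \<omega> \<longrightarrow> x < X \<omega>"
      using AE_space by eventually_elim (auto simp: D_def)
    then show ?thesis ..
  qed
qed

text \<open>A superlevel set of \<open>X + Y\<close> at level x + y contains the intersection of the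
  superlevel sets of \<open>X\<close> at x and \<open>Y\<close> at y, and is contained in their
  union. By nesting, both intersection and union are, almost surely, one of the two sets.\<close>

lemma upper_quantile_add:
  assumes X: "X \<in> Linfty M" and Y: "Y \<in> Linfty M" and "comonotone M X Y"
    and \<alpha>: "0 < \<alpha>" "\<alpha> < 1"
  shows "upper_quantile M \<alpha> (\<lambda>\<omega>. X \<omega> + Y \<omega>) = upper_quantile M \<alpha> X + upper_quantile M \<alpha> Y"
    (is "?q = ?x + ?y")
proof (rule antisym)
  have [measurable]: "X \<in> borel_measurable M" "Y \<in> borel_measurable M"
    using X Y by (simp_all add: Linfty_measurable)
  note nested = comonotone_superlevel[OF \<open>X \<in> borel_measurable M\<close> \<open>Y \<in> borel_measurable M\<close> assms(3)]
  note q_iff = upper_quantile_le_iff[OF Linfty_add[OF X Y] \<alpha>]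
  note x_iff = upper_quantile_le_iff[OF X \<alpha>]
  note y_iff = upper_quantile_le_iff[OF Y \<alpha>]
  show "?q \<le> ?x + ?y"
  proof -
    from nested[of ?x ?y]
    have "prob {\<omega> \<in> space M. ?x + ?y < X \<omega> + Y \<omega>} \<le> \<alpha>"
    proof
      assume "AE \<omega> in M. ?x < X \<omega> \<longrightarrow> ?y < Y \<omega>"
      then have "AE \<omega> in M. ?x + ?y < X \<omega> + Y \<omega> \<longrightarrow> ?y < Y \<omega>"
        by eventually_elim auto
      then have "prob {\<omega> \<in> space M. ?x + ?y < X \<omega> + Y \<omega>} \<le> prob {\<omega> \<in> space M. ?y < Y \<omega>}"
        by (intro finite_measure_mono_AE) (auto elim!: eventually_mono)
      also have "\<dots> \<le> \<alpha>"
        using y_iff[of ?y] by simp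
      finally show ?thesis .
    next
      assume "AE \<omega> in M. ?y < Y \<omega> \<longrightarrow> ?x < X \<omega>"
      then have "AE \<omega> in M. ?x + ?y < X \<omega> + Y \<omega> \<longrightarrow> ?x < X \<omega>"
        by eventually_elim auto
      then have "prob {\<omega> \<in> space M. ?x + ?y < X \<omega> + Y \<omega>} \<le> prob {\<omega> \<in> space M. ?x < X \<omega>}"
        by (intro finite_measure_mono_AE) (auto elim!: eventually_mono)
      also have "\<dots> \<le> \<alpha>"
        using x_iff[of ?x] by simp
      finally show ?thesis .
    qed
    then show ?thesis
      by (simp add: q_iff)
  qed
  show "?x + ?y \<le> ?q"
  proof (rule ccontr)
    assume less: "\<not> ?x + ?y \<le> ?q"
    \<comment> \<open>Halving the gap gives two levels that sum to \<open>?q\<close> and lie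
      strictly below the respective quantiles, where both tails still exceed \<alpha>.\<close>
    define d where "d = (?x + ?y - ?q) / 2"
    have d: "0 < d" "?q = (?x - d) + (?y - d)"
      using less by (auto simp: d_def field_simps)
    have gt: "\<alpha> < prob {\<omega> \<in> space M. ?x - d < X \<omega>}" "\<alpha> < prob {\<omega> \<in> space M. ?y - d < Y \<omega>}"
      using x_iff[of "?x - d"] y_iff[of "?y - d"] d(1) by auto
    from nested[of "?x - d" "?y - d"] have "\<alpha> < prob {\<omega> \<in> space M. ?q < X \<omega> + Y \<omega>}"
    proof
      assume "AE \<omega> in M. ?x - d < X \<omega> \<longrightarrow> ?y - d < Y \<omega>"
      then have "AE \<omega> in M. ?x - d < X \<omega> \<longrightarrow> ?q < X \<omega> + Y \<omega>"
        by eventually_elim (use d(2) in auto)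
      then have "prob {\<omega> \<in> space M. ?x - d < X \<omega>} \<le> prob {\<omega> \<in> space M. ?q < X \<omega> + Y \<omega>}"
        by (intro finite_measure_mono_AE) (auto elim!: eventually_mono)
      then show ?thesis
        using gt(1) by simp
    next
      assume "AE \<omega> in M. ?y - d < Y \<omega> \<longrightarrow> ?x - d < X \<omega>"
      then have "AE \<omega> in M. ?y - d < Y \<omega> \<longrightarrow> ?q < X \<omega> + Y \<omega>"
        by eventually_elim (use d(2) in auto)
      then have "prob {\<omega> \<in> space M. ?y - d < Y \<omega>} \<le> prob {\<omega> \<in> space M. ?q < X \<omega> + Y \<omega>}"
        by (intro finite_measure_mono_AE) (auto elim!: eventually_mono)
      then show ?thesis
        using gt(2) by simp
    qed
    then show False
      using q_iff[of ?q] by simp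
  qed
qed

section \<open>The risk measure of an eligible asset as a quantile\<close>

text \<open>Dividing by the payoff turns the condition into \<open>m < Z \<omega>\<close>; the lower
  bound \<open>\<epsilon>\<close> on the payoff keeps \<open>Z\<close> essentially bounded, so the
  quantile criterion applies.\<close>

lemma SVaR_le_iff:
  assumes S: "eligible_asset M (S0, S1)" and X: "X \<in> Linfty M" and \<alpha>: "0 < \<alpha>" "\<alpha> < 1"
  shows "SVaR M (S0, S1) \<alpha> X \<le> m \<longleftrightarrow> prob {\<omega> \<in> space M. X \<omega> + m / S0 * S1 \<omega> < 0} \<le> \<alpha>"
proof -
  obtain \<epsilon> where S0: "0 < S0" and S1: "S1 \<in> Linfty M" and \<epsilon>: "0 < \<epsilon>" "AE \<omega> in M. \<epsilon> \<le> S1 \<omega>"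
    using S by (rule eligible_assetE)
  have [measurable]: "S1 \<in> borel_measurable M" "X \<in> borel_measurable M"
    using S1 X by (simp_all add: Linfty_measurable)
  define Z where "Z = (\<lambda>\<omega>. - X \<omega> * S0 / S1 \<omega>)"
  have [measurable]: "Z \<in> borel_measurable M"
    unfolding Z_def by measurable
  obtain C where C: "0 < C" "AE \<omega> in M. \<bar>X \<omega>\<bar> \<le> C"
    using X by (rule LinftyE)
  have "AE \<omega> in M. \<bar>Z \<omega>\<bar> \<le> C * S0 / \<epsilon>"
    using C(2) \<epsilon>(2)
  proof eventually_elim
    case (elim \<omega>)
    then show ?case
      using S0 C(1) \<epsilon>(1) by (auto simp: Z_def abs_mult intro!: frac_le mult_right_mono)
  qed
  then have Z: "Z \<in> Linfty M"
    by (intro LinftyI[where C = "C * S0 / \<epsilon>"]) measurable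
  have eq: "prob {\<omega> \<in> space M. X \<omega> + m / S0 * S1 \<omega> < 0} = prob {\<omega> \<in> space M. m < Z \<omega>}" for m
  proof (rule finite_measure_eq_AE)
    show "AE \<omega> in M. \<omega> \<in> {\<omega> \<in> space M. X \<omega> + m / S0 * S1 \<omega> < 0} \<longleftrightarrow>
        \<omega> \<in> {\<omega> \<in> space M. m < Z \<omega>}"
      using \<epsilon>(2)
    proof eventually_elim
      case (elim \<omega>)
      then show ?case
        using S0 \<epsilon>(1) by (auto simp: Z_def field_simps)
    qed
  qed auto
  then have "SVaR M (S0, S1) \<alpha> X = upper_quantile M \<alpha> Z"
    by (simp add: SVaR_def upper_quantile_def)
  then show ?thesis
    using upper_quantile_le_iff[OF Z \<alpha>] eq by simp
qed

text \<open>The added asset position can be counted as capital, which shifts \<open>m\<close> by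
  \<open>c\<close>. Both sides thus have the same upper bounds, and such reals are equal.\<close>

lemma SVaR_add_asset:
  assumes S: "eligible_asset M (S0, S1)" and X: "X \<in> Linfty M" and \<alpha>: "0 < \<alpha>" "\<alpha> < 1"
  shows "SVaR M (S0, S1) \<alpha> (\<lambda>\<omega>. X \<omega> + c / S0 * S1 \<omega>) = SVaR M (S0, S1) \<alpha> X - c" (is "?l = ?r")
proof -
  have Y: "(\<lambda>\<omega>. X \<omega> + c / S0 * S1 \<omega>) \<in> Linfty M"
    using S by (elim eligible_assetE) (intro Linfty_add Linfty_cmult X)
  have "?l \<le> m \<longleftrightarrow> ?r \<le> m" for m
  proof -
    have "?l \<le> m \<longleftrightarrow> SVaR M (S0, S1) \<alpha> X \<le> m + c"
      unfolding SVaR_le_iff[OF S Y \<alpha>] SVaR_le_iff[OF S X \<alpha>]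
      by (simp add: add_divide_distrib algebra_simps)
    then show ?thesis
      by (simp add: algebra_simps)
  qed
  from this[of ?l] this[of ?r] show ?thesis
    by simp
qed

section \<open>From a comonotonic risk measure to an absorbing event\<close>

lemma comonotonic_SVaR_imp_absorbing:
  assumes S: "eligible_asset M (S0, S1)" "risky M (S0, S1)"
    and com: "comonotonic M (SVaR M (S0, S1) \<alpha>)" and \<alpha>: "0 < \<alpha>" "\<alpha> < 1"
  shows "\<exists>A\<in>events. 0 < prob A \<and> (\<forall>B\<in>events. prob B \<le> \<alpha> \<longrightarrow> prob (A \<union> B) \<le> \<alpha>)"
proof -
  define \<rho> where "\<rho> = SVaR M (S0, S1) \<alpha>"
  have S0: "0 < S0" and S1: "S1 \<in> Linfty M"
    using S(1) by (auto elim: eligible_assetE)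
  have add_const: "\<rho> (\<lambda>\<omega>. X \<omega> + c) = \<rho> X + \<rho> (\<lambda>_. c)" if "X \<in> Linfty M" for X c
    using com[unfolded comonotonic_def, rule_format, OF that Linfty_const comonotone_const]
    by (simp add: \<rho>_def)
  define \<kappa> where "\<kappa> = - \<rho> (\<lambda>_. 1)"
  \<comment> \<open>Additivity on 0 + 0 gives \<rho>(0) = 0, and on 1 + (-1) it then gives
    \<rho>(-1) = -\<rho>(1).\<close>
  have \<rho>_unit: "\<rho> (\<lambda>_. t) = - t * \<kappa>" if "t \<in> {1, - 1}" for t
    using that add_const[OF Linfty_const, of 0 0] add_const[OF Linfty_const, of 1 "- 1"]
    by (auto simp: \<kappa>_def)
  \<comment> \<open>The constant 1 contributes \<open>- \<kappa>\<close> to \<open>\<rho>\<close>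
    and the asset term contributes \<open>\<kappa>\<close>, so the two cancel.\<close>
  define V where "V = (\<lambda>\<omega>. 1 + (- \<kappa> / S0) * S1 \<omega>)"
  have V: "V \<in> Linfty M"
    unfolding V_def by (intro Linfty_add Linfty_const Linfty_cmult S1)
  then have [measurable]: "V \<in> borel_measurable M"
    by (rule Linfty_measurable)
  have invariant: "\<rho> (\<lambda>\<omega>. W \<omega> + t * V \<omega>) = \<rho> W" if "W \<in> Linfty M" "t \<in> {1, - 1}" for W t
  proof -
    have "\<rho> (\<lambda>\<omega>. W \<omega> + t * V \<omega>) = \<rho> (\<lambda>\<omega>. (W \<omega> + t) + (- t * \<kappa>) / S0 * S1 \<omega>)"
      by (simp add: V_def algebra_simps)
    also have "\<dots> = \<rho> (\<lambda>\<omega>. W \<omega> + t) + t * \<kappa>"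
      unfolding \<rho>_def using SVaR_add_asset[OF S(1) Linfty_add[OF that(1) Linfty_const] \<alpha>, of t "- t * \<kappa>"]
      by simp
    also have "\<dots> = \<rho> W"
      using add_const[OF that(1), of t] \<rho>_unit[OF that(2)] by simp
    finally show ?thesis .
  qed
  obtain C where C: "0 < C" "AE \<omega> in M. \<bar>V \<omega>\<bar> \<le> C"
    using V by (rule LinftyE)
  have absorb: "prob ({\<omega> \<in> space M. t * V \<omega> < 0} \<union> B) \<le> \<alpha>"
    if [measurable]: "B \<in> events" and B: "prob B \<le> \<alpha>" and t: "t \<in> {1, - 1}" for t B
  proof -
    \<comment> \<open>The height \<open>C + 1\<close> exceeds the essential bound of
      \<open>V\<close>: on \<open>B\<close> the sum \<open>W + t * V\<close> is almost surely at
      most -1, while off \<open>B\<close> it equals \<open>t * V\<close>.\<close>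
    define W where "W = (\<lambda>\<omega>. - (C + 1) * indicator B \<omega>)"
    have W: "W \<in> Linfty M"
      unfolding W_def by (intro Linfty_cmult Linfty_indicator) fact
    have W': "(\<lambda>\<omega>. W \<omega> + t * V \<omega>) \<in> Linfty M"
      using W V by (intro Linfty_add Linfty_cmult)
    then have [measurable]: "(\<lambda>\<omega>. W \<omega> + t * V \<omega>) \<in> borel_measurable M"
      by (rule Linfty_measurable)
    have "{\<omega> \<in> space M. W \<omega> < 0} = B"
      using sets.sets_into_space[OF that(1)] C(1) by (auto simp: W_def indicator_def)
    then have "\<rho> W \<le> 0"
      using SVaR_le_iff[OF S(1) W \<alpha>, of 0] B by (simp add: \<rho>_def)
    then have "\<rho> (\<lambda>\<omega>. W \<omega> + t * V \<omega>) \<le> 0"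
      using invariant[OF W t] by simp
    then have "prob {\<omega> \<in> space M. W \<omega> + t * V \<omega> < 0} \<le> \<alpha>"
      using SVaR_le_iff[OF S(1) W' \<alpha>, of 0] by (simp add: \<rho>_def)
    moreover have "prob ({\<omega> \<in> space M. t * V \<omega> < 0} \<union> B) \<le> prob {\<omega> \<in> space M. W \<omega> + t * V \<omega> < 0}"
    proof (rule finite_measure_mono_AE)
      show "AE \<omega> in M. \<omega> \<in> {\<omega> \<in> space M. t * V \<omega> < 0} \<union> B \<longrightarrow>
          \<omega> \<in> {\<omega> \<in> space M. W \<omega> + t * V \<omega> < 0}"
        using C(2) AE_space
      proof eventually_elim
        case (elim \<omega>)
        then show ?case
          using t C(1) by (auto simp: W_def indicator_def)
      qed
    qed measurable
    ultimately show ?thesis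
      by simp
  qed
  have "\<exists>t\<in>{1, - 1}. 0 < prob {\<omega> \<in> space M. t * V \<omega> < 0}"
  proof (rule ccontr)
    assume "\<not> ?thesis"
    then have "prob {\<omega> \<in> space M. V \<omega> < 0} = 0" "prob {\<omega> \<in> space M. - V \<omega> < 0} = 0"
      by (auto simp: not_less intro!: antisym)
    then have "AE \<omega> in M. \<not> V \<omega> < 0" "AE \<omega> in M. \<not> - V \<omega> < 0"
      by (auto simp: prob_Collect_eq_0)
    then have "AE \<omega> in M. V \<omega> = 0"
      by eventually_elim auto
    \<comment> \<open>If \<open>\<kappa>\<close> were 0, then \<open>V\<close> would be 1; so the
      quotient is a genuine one and the payoff is constant.\<close>
    then have "AE \<omega> in M. S1 \<omega> = S0 / \<kappa>"
    proof eventually_elim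
      case (elim \<omega>)
      then have "\<kappa> \<noteq> 0"
        by (auto simp: V_def)
      then show ?case
        using elim S0 by (auto simp: V_def field_simps)
    qed
    then show False
      using S(2) by (auto simp: risk_free_def)
  qed
  then obtain t where "t \<in> {1, - 1}" "0 < prob {\<omega> \<in> space M. t * V \<omega> < 0}"
    by blast
  then show ?thesis
    using absorb by (intro bexI[of _ "{\<omega> \<in> space M. t * V \<omega> < 0}"]) auto
qed

section \<open>From an absorbing event to a risky asset\<close>

text \<open>The payoff 1 + 1_A is not constant because \<open>A\<close> has probability strictly
  between 0 and 1. Absorption makes the risk measure blind to what happens inside \<open>A\<close>,
  where alone this payoff differs from cash.\<close>

lemma absorbing_imp_comonotonic_SVaR:
  assumes A [measurable]: "A \<in> events" and pos: "0 < prob A" and less: "prob A < 1"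
    and absorb: "\<And>B. B \<in> events \<Longrightarrow> prob B \<le> \<alpha> \<Longrightarrow> prob (A \<union> B) \<le> \<alpha>"
    and \<alpha>: "0 < \<alpha>" "\<alpha> < 1"
  shows "\<exists>S. eligible_asset M S \<and> risky M S \<and> comonotonic M (SVaR M S \<alpha>)"
proof -
  define U :: "'a \<Rightarrow> real" where "U = (\<lambda>\<omega>. 1 + indicator A \<omega>)"
  have U: "U \<in> Linfty M"
    unfolding U_def by (intro Linfty_add Linfty_const Linfty_indicator A)
  then have [measurable]: "U \<in> borel_measurable M"
    by (rule Linfty_measurable)
  have "eligible_asset M (1, U)"
    using U by (auto simp: eligible_asset_def Linfty_nonneg_def U_def intro!: exI[of _ 1])
  moreover have "risky M (1, U)"
  proof
    assume "risk_free M (1, U)"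
    then obtain c where c: "AE \<omega> in M. U \<omega> = c"
      by (auto simp: risk_free_def)
    have "(AE \<omega> in M. \<omega> \<in> A) \<or> (AE \<omega> in M. \<omega> \<notin> A)"
    proof (cases "c = 2")
      case True
      from c have "AE \<omega> in M. \<omega> \<in> A"
        by eventually_elim (auto simp: True U_def indicator_def split: if_splits)
      then show ?thesis ..
    next
      case False
      from c have "AE \<omega> in M. \<omega> \<notin> A"
        by eventually_elim (use False in \<open>auto simp: U_def\<close>)
      then show ?thesis ..
    qed
    then show False
      using pos less prob_eq_1[OF A] prob_eq_0[OF A] by auto
  qed
  moreover have "comonotonic M (SVaR M (1, U) \<alpha>)"
  proof -
    \<comment> \<open>Events agreeing off \<open>A\<close> satisfy E \<subseteq> A \<union> F, and
      absorption bounds the right-hand side. Exchanging the roles yields an equivalence.\<close>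
    have sub: "prob E \<le> \<alpha>" if "E \<in> events" "F \<in> events" "E - A = F - A" "prob F \<le> \<alpha>" for E F
    proof -
      have "prob E \<le> prob (A \<union> F)"
        using that by (intro finite_measure_mono) auto
      also have "\<dots> \<le> \<alpha>"
        using that by (intro absorb)
      finally show ?thesis .
    qed
    have SVaR_eq: "SVaR M (1, U) \<alpha> X = upper_quantile M \<alpha> (\<lambda>\<omega>. - X \<omega>)" if "X \<in> Linfty M" for X
    proof -
      have [measurable]: "X \<in> borel_measurable M"
        using that by (rule Linfty_measurable)
      have "prob {\<omega> \<in> space M. X \<omega> + m * U \<omega> < 0} \<le> \<alpha> \<longleftrightarrow> prob {\<omega> \<in> space M. m < - X \<omega>} \<le> \<alpha>" for m
      proof -
        have diff: "{\<omega> \<in> space M. X \<omega> + m * U \<omega> < 0} - A = {\<omega> \<in> space M. m < - X \<omega>} - A"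
          by (auto simp: U_def)
        show ?thesis
          using sub[OF _ _ diff] sub[OF _ _ diff[symmetric]] by auto
      qed
      then show ?thesis
        by (simp add: SVaR_def upper_quantile_def)
    qed
    show ?thesis
      unfolding comonotonic_def
    proof (intro ballI impI)
      fix X Y assume XY: "X \<in> Linfty M" "Y \<in> Linfty M" and "comonotone M X Y"
      then have "upper_quantile M \<alpha> (\<lambda>\<omega>. - X \<omega> + - Y \<omega>) =
          upper_quantile M \<alpha> (\<lambda>\<omega>. - X \<omega>) + upper_quantile M \<alpha> (\<lambda>\<omega>. - Y \<omega>)"
        using Linfty_cmult[of X M "- 1"] Linfty_cmult[of Y M "- 1"] comonotone_uminus \<alpha>
        by (intro upper_quantile_add) auto
      then show "SVaR M (1, U) \<alpha> (\<lambda>\<omega>. X \<omega> + Y \<omega>) = SVaR M (1, U) \<alpha> X + SVaR M (1, U) \<alpha> Y"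
        using XY by (simp add: SVaR_eq Linfty_add)
    qed
  qed
  ultimately show ?thesis
    by blast
qed

end

theorem lemma3p3:
  fixes M :: "'a measure" and \<alpha> :: real
  assumes "prob_space M" and "0 < \<alpha>" and "\<alpha> < 1"
  shows "(\<exists>S. eligible_asset M S \<and> risky M S \<and> comonotonic M (SVaR M S \<alpha>)) \<longleftrightarrow>
         (\<exists>A\<in>sets M. 0 < measure M A \<and> measure M A \<le> \<alpha> \<and>
            (\<forall>B\<in>sets M. measure M B \<le> \<alpha> \<longrightarrow>
               measure M A + measure M ((space M - A) \<inter> B) \<le> \<alpha>))"
proof -
  interpret prob_space M
    by fact
  \<comment> \<open>The sum in the statement is the probability of a union split along
    \<open>A\<close>, which is the form used by the two implications.\<close>
  have union: "prob A + prob ((space M - A) \<inter> B) = prob (A \<union> B)"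
    if "A \<in> events" "B \<in> events" for A B
  proof -
    have "(space M - A) \<inter> B = B - A"
      using sets.sets_into_space[OF that(2)] by auto
    then show ?thesis
      using that finite_measure_Union'[of A B] by simp
  qed
  show ?thesis
  proof
    assume "\<exists>S. eligible_asset M S \<and> risky M S \<and> comonotonic M (SVaR M S \<alpha>)"
    then obtain A where A: "A \<in> events" "0 < prob A"
      and absorb: "\<And>B. B \<in> events \<Longrightarrow> prob B \<le> \<alpha> \<Longrightarrow> prob (A \<union> B) \<le> \<alpha>"
      using comonotonic_SVaR_imp_absorbing assms(2,3) by (metis surj_pair)
    \<comment> \<open>Absorbing the empty event bounds the probability of \<open>A\<close>
      itself.\<close>
    moreover have "prob A \<le> \<alpha>"
      using absorb[of "{}"] assms(2) by simp
    ultimately show "\<exists>A\<in>sets M. 0 < measure M A \<and> measure M A \<le> \<alpha> \<and>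
        (\<forall>B\<in>sets M. measure M B \<le> \<alpha> \<longrightarrow>
          measure M A + measure M ((space M - A) \<inter> B) \<le> \<alpha>)"
      using union by auto
  next
    assume "\<exists>A\<in>sets M. 0 < measure M A \<and> measure M A \<le> \<alpha> \<and>
        (\<forall>B\<in>sets M. measure M B \<le> \<alpha> \<longrightarrow>
          measure M A + measure M ((space M - A) \<inter> B) \<le> \<alpha>)"
    then obtain A where "A \<in> events" "0 < prob A" "prob A \<le> \<alpha>"
      and "\<And>B. B \<in> events \<Longrightarrow> prob B \<le> \<alpha> \<Longrightarrow> prob (A \<union> B) \<le> \<alpha>"
      using union by auto
    \<comment> \<open>Here \<open>prob A < 1\<close> comes from \<open>prob A \<le> \<alpha>\<close>
      and \<alpha> < 1.\<close>
    then show "\<exists>S. eligible_asset M S \<and> risky M S \<and> comonotonic M (SVaR M S \<alpha>)"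
      using assms(2,3) by (intro absorbing_imp_comonotonic_SVaR) auto
  qed
qed

end
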